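(* Let $\mathscr{N}$ be a (finite-dimensional, real) nilpotent Jordan algebra that is nontrivial, i.e. whose product is not identically zero. Then $\mathscr{N}$ admits no Jordan-Einstein metric.
   Context: A (real) Jordan algebra is a real vector space $\mathscr{A}$ with a bilinear product satisfying $XY=YX$ and $X(X^2Y)=X^2(XY)$. It is nilpotent if $\mathscr{A}^m=0$ for some $m$, where $\mathscr{A}^0=\mathscr{A}$, $\mathscr{A}^{k+1}=\mathscr{A}\mathscr{A}^k$ (span of products). Given an arbitrary (positive definite) inner product $\langle\cdot,\cdot\rangle$ on $\mathscr{A}$, the Jordan-Levi-Civita connection is the unique bilinear map $(X,Y)\mapsto\nabla_XY$ with $\nabla_XY+\nabla_YX=XY$ and $\langle\nabla_XY,Z\rangle=\langle Y,\nabla_XZ\rangle$ for all $X,Y,Z$; explicitly $\langle\nabla_XY,Z\rangle=\frac12(\langle XY,Z\rangle-\langle YZ,X\rangle+\langle ZX,Y\rangle)$. The Jordan curvature tensor is $R(X,Y)Z=-\nabla_X\nabla_YZ-\nabla_Y\nabla_XZ+\nabla_{XY}Z$. Put $\operatorname{ric}(U,V)=\operatorname{Tr}(X\mapsto R(U,X)V)$ and $\operatorname{Ric}(U,V)=\frac12(\operatorname{ric}(U,V)+\operatorname{ric}(V,U))$. The inner product is a Jordan-Einstein metric if $\operatorname{Ric}=c\langle\cdot,\cdot\rangle$ for some constant $c\in\mathbb{R}$. *)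

theory Defs
  imports "HOL-Analysis.Analysis"
begin

text \<open>A real algebra is given by its product \<open>mul\<close> on a type of class \<open>real_vector\<close>. That class carries
  no norm or inner product, so the metrics \<open>ip\<close> below are arbitrary.\<close>

definition finite_dimensional :: "'a::real_vector itself \<Rightarrow> bool" where
  "finite_dimensional _ \<longleftrightarrow> (\<exists>B::'a set. finite B \<and> span B = UNIV)"

definition jordan_algebra :: "('a::real_vector \<Rightarrow> 'a \<Rightarrow> 'a) \<Rightarrow> bool" where
  "jordan_algebra mul \<longleftrightarrow> bilinear mul \<and>
     (\<forall>X Y. mul X Y = mul Y X) \<and>
     (\<forall>X Y. mul X (mul (mul X X) Y) = mul (mul X X) (mul X Y))"

primrec algebra_power :: "('a::real_vector \<Rightarrow> 'a \<Rightarrow> 'a) \<Rightarrow> nat \<Rightarrow> 'a set" where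
  "algebra_power mul 0 = UNIV"
| "algebra_power mul (Suc k) = span {mul X Y | X Y. Y \<in> algebra_power mul k}"

definition nilpotent_algebra :: "('a::real_vector \<Rightarrow> 'a \<Rightarrow> 'a) \<Rightarrow> bool" where
  "nilpotent_algebra mul \<longleftrightarrow> (\<exists>m. algebra_power mul m = {0})"

definition is_inner_product :: "('a::real_vector \<Rightarrow> 'a \<Rightarrow> real) \<Rightarrow> bool" where
  "is_inner_product ip \<longleftrightarrow> bilinear ip \<and> (\<forall>X Y. ip X Y = ip Y X) \<and> (\<forall>X. X \<noteq> 0 \<longrightarrow> ip X X > 0)"

definition is_jordan_levi_civita ::
  "('a::real_vector \<Rightarrow> 'a \<Rightarrow> 'a) \<Rightarrow> ('a \<Rightarrow> 'a \<Rightarrow> real) \<Rightarrow> ('a \<Rightarrow> 'a \<Rightarrow> 'a) \<Rightarrow> bool" where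
  "is_jordan_levi_civita mul ip D \<longleftrightarrow> bilinear D \<and>
     (\<forall>X Y. D X Y + D Y X = mul X Y) \<and>
     (\<forall>X Y Z. ip (D X Y) Z = ip Y (D X Z))"

text \<open>Existence and uniqueness are proved in \<open>ex1_jordan_levi_civita\<close> below.\<close>

definition jordan_levi_civita ::
  "('a::real_vector \<Rightarrow> 'a \<Rightarrow> 'a) \<Rightarrow> ('a \<Rightarrow> 'a \<Rightarrow> real) \<Rightarrow> 'a \<Rightarrow> 'a \<Rightarrow> 'a" where
  "jordan_levi_civita mul ip = (THE D. is_jordan_levi_civita mul ip D)"

definition jordan_curvature ::
  "('a::real_vector \<Rightarrow> 'a \<Rightarrow> 'a) \<Rightarrow> ('a \<Rightarrow> 'a \<Rightarrow> real) \<Rightarrow> 'a \<Rightarrow> 'a \<Rightarrow> 'a \<Rightarrow> 'a" where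
  "jordan_curvature mul ip X Y Z =
     (let D = jordan_levi_civita mul ip in - D X (D Y Z) - D Y (D X Z) + D (mul X Y) Z)"

text \<open>The trace of an endomorphism with respect to some basis; by \<open>endo_trace_eq\<close> below the choice
  does not matter for a linear map on a finite-dimensional space.\<close>

definition endo_trace :: "('a::real_vector \<Rightarrow> 'a) \<Rightarrow> real" where
  "endo_trace f = (let B = (SOME B. independent B \<and> span B = UNIV) in
     \<Sum>b\<in>B. representation B (f b) b)"

definition jordan_ric ::
  "('a::real_vector \<Rightarrow> 'a \<Rightarrow> 'a) \<Rightarrow> ('a \<Rightarrow> 'a \<Rightarrow> real) \<Rightarrow> 'a \<Rightarrow> 'a \<Rightarrow> real" where
  "jordan_ric mul ip U V = endo_trace (\<lambda>X. jordan_curvature mul ip U X V)"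

definition jordan_Ric ::
  "('a::real_vector \<Rightarrow> 'a \<Rightarrow> 'a) \<Rightarrow> ('a \<Rightarrow> 'a \<Rightarrow> real) \<Rightarrow> 'a \<Rightarrow> 'a \<Rightarrow> real" where
  "jordan_Ric mul ip U V = (jordan_ric mul ip U V + jordan_ric mul ip V U) / 2"

definition jordan_einstein_metric ::
  "('a::real_vector \<Rightarrow> 'a \<Rightarrow> 'a) \<Rightarrow> ('a \<Rightarrow> 'a \<Rightarrow> real) \<Rightarrow> bool" where
  "jordan_einstein_metric mul ip \<longleftrightarrow> is_inner_product ip \<and>
     (\<exists>c::real. \<forall>U V. jordan_Ric mul ip U V = c * ip U V)"

lemma endo_trace_basis_independent:
  fixes f :: "'a::real_vector \<Rightarrow> 'a"
  assumes f: "linear f" and B: "finite B" "independent B" "span B = UNIV"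
    and C: "finite C" "independent C" "span C = UNIV"
  shows "(\<Sum>b\<in>B. representation B (f b) b) = (\<Sum>c\<in>C. representation C (f c) c)"
proof -
  interpret f: linear f by (rule f)
  have lB: "linear (\<lambda>v. representation B v b)" for b
    by (auto simp: linear_iff real_vector.representation_add real_vector.representation_scale B)
  have lC: "linear (\<lambda>v. representation C v b)" for b
    by (auto simp: linear_iff real_vector.representation_add real_vector.representation_scale C)
  have sB: "(\<Sum>b\<in>B. representation B v b *\<^sub>R b) = v" for v
    by (rule real_vector.sum_representation_eq) (use B in auto)
  have sC: "(\<Sum>b\<in>C. representation C v b *\<^sub>R b) = v" for v
    by (rule real_vector.sum_representation_eq) (use C in auto)
  have "representation B (f b) b = (\<Sum>c\<in>C. representation C b c * representation B (f c) b)" for b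
  proof -
    have "representation B (f b) b = representation B (f (\<Sum>c\<in>C. representation C b c *\<^sub>R c)) b"
      by (simp add: sC)
    also have "\<dots> = (\<Sum>c\<in>C. representation C b c * representation B (f c) b)"
      by (simp add: f.sum f.scale linear_sum[OF lB] linear_scale[OF lB])
    finally show ?thesis .
  qed
  moreover have "representation C (f c) c = (\<Sum>b\<in>B. representation C b c * representation B (f c) b)" for c
  proof -
    have "representation C (f c) c = representation C (\<Sum>b\<in>B. representation B (f c) b *\<^sub>R b) c"
      by (simp add: sB)
    also have "\<dots> = (\<Sum>b\<in>B. representation C b c * representation B (f c) b)"
      by (simp add: linear_sum[OF lC] linear_scale[OF lC] mult.commute)
    finally show ?thesis .
  qed
  ultimately show ?thesis
    by (simp add: sum.swap[of _ C B])
qed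

lemma endo_trace_eq:
  fixes f :: "'a::real_vector \<Rightarrow> 'a"
  assumes "linear f" "finite B" "independent B" "span B = UNIV"
  shows "endo_trace f = (\<Sum>b\<in>B. representation B (f b) b)"
proof -
  define C where "C = (SOME C::'a set. independent C \<and> span C = UNIV)"
  have "independent C \<and> span C = UNIV"
    unfolding C_def by (rule someI) (use assms in auto)
  moreover from this have "finite C"
    using independent_span_bound[of B C] assms by auto
  ultimately show ?thesis
    using endo_trace_basis_independent[of f C B] assms by (simp add: endo_trace_def Let_def C_def)
qed

lemma riesz_span:
  fixes ip :: "'a::real_vector \<Rightarrow> 'a \<Rightarrow> real"
  assumes ip: "is_inner_product ip" and "finite B"
  shows "linear \<phi> \<Longrightarrow> \<exists>z\<in>span B. \<forall>x\<in>span B. ip z x = \<phi> x"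
  using assms(2)
proof (induction B arbitrary: \<phi> rule: finite_induct)
  case empty
  have "ip 0 0 = 0" using ip bilinear_lzero by (auto simp: is_inner_product_def)
  then show ?case using linear_0[OF empty] by simp
next
  case (insert b B)
  note bl = ip[unfolded is_inner_product_def, THEN conjunct1]
  obtain z where z: "z \<in> span B" "\<And>x. x \<in> span B \<Longrightarrow> ip z x = \<phi> x"
    using insert.IH[OF insert.prems] by blast
  have "linear (ip b)" using bl by (simp add: bilinear_def)
  from insert.IH[OF this] obtain p where p: "p \<in> span B" "\<And>x. x \<in> span B \<Longrightarrow> ip p x = ip b x"
    by blast
  define n where "n = b - p"
  have  "ip n x = 0" if "x \<in> span B" for x
    unfolding n_def bilinear_lsub[OF bl] p(2)[OF that] by simp
  moreover have "ip x n = ip n x" for x using ip by (simp add: is_inner_product_def)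
  ultimately have orth: "ip n x = 0" "ip x n = 0" if "x \<in> span B" for x
    using that by simp_all
  show ?case
  proof (cases "n = 0")
    case True
    then have "b \<in> span B" using p by (simp add: n_def)
    then have "span (insert b B) = span B" by (rule span_redundant)
    then show ?thesis using z by auto
  next
    case False
    then have pos: "ip n n > 0" using ip by (simp add: is_inner_product_def)
    define w where "w = z + (\<phi> n / ip n n) *\<^sub>R n"
    have nin: "n \<in> span (insert b B)"
      unfolding n_def using p(1) span_mono[of B "insert b B"] by (auto intro: span_diff span_base)
    have "w \<in> span (insert b B)"
      unfolding w_def using nin z(1) span_mono[of B "insert b B"] by (auto intro: span_add span_scale)
    moreover have "ip w x = \<phi> x" if x: "x \<in> span (insert b B)" for x
    proof -
      obtain k where k: "x - k *\<^sub>R b \<in> span B" using x unfolding span_insert by blast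
      define y where "y = x - k *\<^sub>R n"
      have "y = (x - k *\<^sub>R b) + k *\<^sub>R p" by (simp add: y_def n_def algebra_simps)
      then have y: "y \<in> span B" using k p(1) by (auto intro: span_add span_scale)
      have "x = y + k *\<^sub>R n" by (simp add: y_def)
      then show ?thesis
        using pos orth y z
        by (simp add: w_def bilinear_ladd[OF bl] bilinear_radd[OF bl] bilinear_lmul[OF bl]
            bilinear_rmul[OF bl] linear_add[OF insert.prems] linear_scale[OF insert.prems])
    qed
    ultimately show ?thesis by blast
  qed
qed

lemma is_inner_product_eqI:
  assumes ip: "is_inner_product ip" and eq: "\<And>z. ip x z = ip y z"
  shows "x = y"
proof (rule ccontr)
  assume "x \<noteq> y"
  then have "ip (x - y) (x - y) > 0" using ip by (simp add: is_inner_product_def)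
  moreover have "ip (x - y) (x - y) = 0"
    using ip eq[of "x - y"] by (simp add: is_inner_product_def bilinear_lsub)
  ultimately show False by simp
qed

lemma is_jordan_levi_civita_koszul:
  fixes mul :: "'a::real_vector \<Rightarrow> 'a \<Rightarrow> 'a"
  assumes ip: "is_inner_product ip" and D: "is_jordan_levi_civita mul ip D"
  shows "ip (D X Y) Z = (ip (mul X Y) Z - ip (mul Y Z) X + ip (mul Z X) Y) / 2"
proof -
  note bl = ip[unfolded is_inner_product_def, THEN conjunct1]
  have sym: "ip A B = ip B A" for A B using ip by (simp add: is_inner_product_def)
  have m: "mul A B = D A B + D B A" for A B using D by (simp add: is_jordan_levi_civita_def)
  have sa: "ip (D A B) C = ip (D A C) B" for A B C
    using D sym by (metis is_jordan_levi_civita_def)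
  show ?thesis
    unfolding m bilinear_ladd[OF bl]
    using sa[of X Y Z] sa[of Y X Z] sa[of Z X Y] by simp
qed

lemma ex1_jordan_levi_civita:
  fixes mul :: "'a::real_vector \<Rightarrow> 'a \<Rightarrow> 'a"
  assumes fd: "finite_dimensional TYPE('a)" and mul: "bilinear mul" "\<And>X Y. mul X Y = mul Y X"
    and ip: "is_inner_product ip"
  shows "\<exists>!D. is_jordan_levi_civita mul ip D"
proof (rule ex_ex1I)
  note bl = ip[unfolded is_inner_product_def, THEN conjunct1]
  have sym: "ip A B = ip B A" for A B using ip by (simp add: is_inner_product_def)
  note bls = bilinear_ladd[OF bl] bilinear_radd[OF bl] bilinear_lmul[OF bl] bilinear_rmul[OF bl]
    bilinear_ladd[OF mul(1)] bilinear_radd[OF mul(1)] bilinear_lmul[OF mul(1)] bilinear_rmul[OF mul(1)]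
  define K where "K X Y Z = (ip (mul X Y) Z - ip (mul Y Z) X + ip (mul Z X) Y) / 2" for X Y Z
  obtain B :: "'a set" where B: "finite B" "span B = UNIV"
    using fd by (auto simp: finite_dimensional_def)
  have "\<exists>z. \<forall>Z. ip z Z = K X Y Z" for X Y
  proof -
    have "linear (K X Y)"
      by (rule linearI) (simp_all add: K_def bls field_simps)
    from riesz_span[OF ip B(1) this] show ?thesis using B(2) by auto
  qed
  then obtain D where D: "\<And>X Y Z. ip (D X Y) Z = K X Y Z" by metis
  have "is_jordan_levi_civita mul ip D"
    unfolding is_jordan_levi_civita_def bilinear_def
  proof (intro conjI allI)
    show "linear (D X)" for X
      by (rule linearI; rule is_inner_product_eqI[OF ip]) (simp_all add: bls D K_def field_simps)
    show "linear (\<lambda>X. D X Y)" for Y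
      by (rule linearI; rule is_inner_product_eqI[OF ip]) (simp_all add: bls D K_def field_simps)
    show "D X Y + D Y X = mul X Y" for X Y
      by (rule is_inner_product_eqI[OF ip]) (simp add: bls D K_def mul(2) field_simps)
    show "ip (D X Y) Z = ip Y (D X Z)" for X Y Z
      unfolding sym[of Y] by (simp add: D K_def mul(2) field_simps)
  qed
  then show "\<exists>D. is_jordan_levi_civita mul ip D" by blast
next
  fix D E assume "is_jordan_levi_civita mul ip D" "is_jordan_levi_civita mul ip E"
  then show "D = E"
    by (intro ext is_inner_product_eqI[OF ip]) (simp add: is_jordan_levi_civita_koszul[OF ip])
qed

end

theory Submission
  imports Defs
begin

text \<open>
  As for left-invariant metrics on non-abelian nilpotent Lie groups, the Ricci form has negative
  trace but is nonnegative on the vectors that annihilate the algebra, so it cannot be a multiple of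
  the metric.

  Let \<open>D\<close> be the Jordan-Levi-Civita connection, \<open>B\<close> an orthonormal basis and \<open>H = (\<Sum>b\<in>B. D b b)\<close>.
  Each \<open>D U\<close> is self-adjoint, so cyclicity of the trace turns the definition of \<open>ric\<close> into
  \<open>ric U U = tr (A\<^sub>U \<circ> A\<^sub>U) - \<langle>D U U, H\<rangle>\<close>, where \<open>A\<^sub>U X = D X U\<close> (\<open>jordan_ric_diagonal\<close>). By the
  Koszul formula the skew part of \<open>A\<^sub>U\<close> is half of \<open>L\<^sub>U - L\<^sub>U\<^sup>T\<close>, where \<open>L\<^sub>U\<close> is multiplication by \<open>U\<close>,
  and its symmetric part is half of the form \<open>J\<^sub>U(b, c) = \<langle>b c, U\<rangle>\<close>. Hence
  \<open>ric U U = |J\<^sub>U|\<^sup>2 / 4 - |L\<^sub>U|\<^sup>2 / 2 + tr (L\<^sub>U \<circ> L\<^sub>U) / 2 - \<langle>D U U, H\<rangle>\<close> (\<open>jordan_ric_structure_constants\<close>).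

  Nilpotency is used twice. First, \<open>tr (L\<^sub>U \<circ> L\<^sub>U) = 0\<close>; this is read off from an orthonormal basis
  adapted to the powers of the algebra (\<open>adapted_orthonormal_basis\<close>), each of whose members is
  orthogonal to the power into which multiplication moves it. Summing over \<open>U \<in> B\<close>, both \<open>|J\<^sub>U|\<^sup>2\<close>
  and \<open>|L\<^sub>U|\<^sup>2\<close> add up to the sum \<open>N\<close> of all squared structure constants, so the scalar curvature
  is \<open>- N / 4 - |H|\<^sup>2\<close>. It is negative as soon as the product is nonzero, and so is the Einstein
  constant. Second, the last nonzero power contains some \<open>Z \<noteq> 0\<close> that annihilates the algebra, and
  there \<open>ric Z Z = |J\<^sub>Z|\<^sup>2 / 4 \<ge> 0\<close>. This is a contradiction.
\<close>

section \<open>Orthonormal bases of an arbitrary inner product\<close>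

definition orthonormal :: "('a::real_vector \<Rightarrow> 'a \<Rightarrow> real) \<Rightarrow> 'a set \<Rightarrow> bool" where
  "orthonormal ip B \<longleftrightarrow> finite B \<and> (\<forall>b\<in>B. \<forall>c\<in>B. ip b c = (if b = c then 1 else 0))"

locale inner_product =
  fixes ip :: "'a::real_vector \<Rightarrow> 'a \<Rightarrow> real"
  assumes ip: "is_inner_product ip"
begin

lemma bilinear_ip: "bilinear ip"
  and sym: "ip x y = ip y x"
  and pos: "x \<noteq> 0 \<Longrightarrow> ip x x > 0"
  using ip by (auto simp: is_inner_product_def)

lemma linear_left: "linear (\<lambda>x. ip x y)" and linear_right: "linear (ip x)"
  using bilinear_ip by (auto simp: bilinear_def)

lemmas ip_simps =
  linear_add[OF linear_left] linear_diff[OF linear_left] linear_neg[OF linear_left]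
  linear_scale[OF linear_left] linear_sum[OF linear_left] linear_0[OF linear_left]
  linear_add[OF linear_right] linear_diff[OF linear_right] linear_neg[OF linear_right]
  linear_scale[OF linear_right] linear_sum[OF linear_right] linear_0[OF linear_right]

lemma nonneg: "ip x x \<ge> 0"
  using pos[of x] by (cases "x = 0") (auto simp: ip_simps)

lemma sum_mult_orthonormal:
  assumes "orthonormal ip B" "c \<in> B"
  shows "(\<Sum>b\<in>B. f b * ip b c) = f c"
proof -
  have "(\<Sum>b\<in>B. f b * ip b c) = (\<Sum>b\<in>B. if b = c then f b else 0)"
    using assms by (intro sum.cong) (auto simp: orthonormal_def)
  then show ?thesis using assms by (simp add: orthonormal_def)
qed

lemma orthonormal_independent:
  assumes "orthonormal ip B"
  shows "independent B"
proof (subst independent_explicit_finite_subsets, intro allI impI ballI)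
  fix A u v assume A: "A \<subseteq> B" "finite A" "(\<Sum>w\<in>A. u w *\<^sub>R w) = 0" "v \<in> A"
  have "orthonormal ip A"
    using assms A(1,2) unfolding orthonormal_def by (meson subsetD)
  then have "u v = ip (\<Sum>w\<in>A. u w *\<^sub>R w) v"
    using A(4) by (simp add: ip_simps sum_mult_orthonormal)
  then show "u v = 0" using A by (simp add: ip_simps)
qed

lemma orthonormal_expansion:
  assumes B: "orthonormal ip B" "span B = UNIV"
  shows "representation B v = (\<lambda>b. if b \<in> B then ip v b else 0)"
    and "(\<Sum>b\<in>B. ip v b *\<^sub>R b) = v"
proof -
  note i = orthonormal_independent[OF B(1)]
  have rep: "(\<Sum>b\<in>B. representation B v b *\<^sub>R b) = v" for v
    by (rule real_vector.sum_representation_eq) (use B i in \<open>auto simp: orthonormal_def\<close>)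
  have eq: "representation B v c = ip v c" if "c \<in> B" for c
  proof -
    have "ip v c = ip (\<Sum>b\<in>B. representation B v b *\<^sub>R b) c" by (simp add: rep)
    also have "\<dots> = representation B v c"
      using that B by (simp add: ip_simps sum_mult_orthonormal)
    finally show ?thesis by simp
  qed
  show "representation B v = (\<lambda>b. if b \<in> B then ip v b else 0)"
    using eq real_vector.representation_ne_zero by fastforce
  show "(\<Sum>b\<in>B. ip v b *\<^sub>R b) = v"
    using rep[of v] by (simp add: eq)
qed

lemma parseval:
  assumes "orthonormal ip B" "span B = UNIV"
  shows "ip x y = (\<Sum>b\<in>B. ip x b * ip y b)"
proof -
  have "ip x y = ip (\<Sum>b\<in>B. ip x b *\<^sub>R b) y"
    by (simp add: orthonormal_expansion[OF assms])
  then show ?thesis by (simp add: ip_simps sym[of y])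
qed

lemma endo_trace_orthonormal:
  assumes B: "orthonormal ip B" "span B = UNIV" and "linear f"
  shows "endo_trace f = (\<Sum>b\<in>B. ip (f b) b)"
proof -
  have "endo_trace f = (\<Sum>b\<in>B. representation B (f b) b)"
    using assms orthonormal_independent[OF B(1)] by (intro endo_trace_eq) (auto simp: orthonormal_def)
  then show ?thesis by (simp add: orthonormal_expansion[OF B])
qed

lemma trace_comp_matrix:
  assumes B: "orthonormal ip B" "span B = UNIV" and f: "linear f"
  shows "(\<Sum>b\<in>B. ip (f (g b)) b) = (\<Sum>b\<in>B. \<Sum>c\<in>B. ip (g b) c * ip (f c) b)"
proof (rule sum.cong[OF refl])
  fix b assume "b \<in> B"
  have "ip (f (g b)) b = ip (f (\<Sum>c\<in>B. ip (g b) c *\<^sub>R c)) b"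
    by (simp add: orthonormal_expansion[OF B])
  then show "ip (f (g b)) b = (\<Sum>c\<in>B. ip (g b) c * ip (f c) b)"
    by (simp add: linear_sum[OF f] linear_scale[OF f] ip_simps)
qed

lemma trace_comp_commute:
  assumes B: "orthonormal ip B" "span B = UNIV" and f: "linear f" and g: "linear g"
  shows "(\<Sum>b\<in>B. ip (f (g b)) b) = (\<Sum>b\<in>B. ip (g (f b)) b)"
  unfolding trace_comp_matrix[OF B f] trace_comp_matrix[OF B g]
  by (subst sum.swap) (simp add: mult.commute)

text \<open>A largest orthonormal set of vectors adapted to the filtration must span. Otherwise let \<open>k\<close> be
  the last index for which \<open>V k\<close> leaves the span, and remove from some \<open>v \<in> V k\<close> outside the span its
  projection to the span. Only basis vectors lying in \<open>V k\<close> contribute to that projection, because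
  those of smaller level are orthogonal to \<open>V k\<close>; so the difference stays in \<open>V k\<close>. It is orthogonal
  to \<open>V (Suc k)\<close>, which lies in the span, and after normalisation it enlarges the set.\<close>

lemma adapted_orthonormal_basis:
  fixes V :: "nat \<Rightarrow> 'a set"
  assumes fd: "finite_dimensional TYPE('a)"
    and sub: "\<And>k. subspace (V k)" and dec: "\<And>k. V (Suc k) \<subseteq> V k"
    and top: "V 0 = UNIV" and bot: "V m = {0}"
  obtains B where "orthonormal ip B" "span B = UNIV"
    "\<And>b. b \<in> B \<Longrightarrow> \<exists>k. b \<in> V k \<and> (\<forall>x\<in>V (Suc k). ip x b = 0)"
proof -
  define adapted where "adapted B \<longleftrightarrow> orthonormal ip B \<and>
    (\<forall>b\<in>B. \<exists>k. b \<in> V k \<and> (\<forall>x\<in>V (Suc k). ip x b = 0))" for B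
  have anti: "V l \<subseteq> V k" if "k \<le> l" for k l
    using lift_Suc_antimono_le[of V, OF dec that] .
  obtain S :: "'a set" where S: "finite S" "span S = UNIV"
    using fd by (auto simp: finite_dimensional_def)
  have "card B \<le> card S" if "adapted B" for B
    using independent_span_bound[OF S(1), of B] orthonormal_independent that S(2)
    by (auto simp: adapted_def)
  moreover have "adapted {}" by (simp add: adapted_def orthonormal_def)
  ultimately obtain B where B: "adapted B" and max: "\<And>C. adapted C \<Longrightarrow> card C \<le> card B"
    using ex_has_greatest_nat[of adapted "{}" card "Suc (card S)"] by (metis le_imp_less_Suc)
  have on: "orthonormal ip B" and fin: "finite B"
    using B by (auto simp: adapted_def orthonormal_def)
  have "span B = UNIV"
  proof (rule ccontr)
    assume "span B \<noteq> UNIV"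
    then have n0: "\<not> V 0 \<subseteq> span B" using top by auto
    have "V m \<subseteq> span B" using bot by (simp add: span_zero)
    with n0 obtain k where k: "\<not> V k \<subseteq> span B" "V (Suc k) \<subseteq> span B"
      using ex_least_nat_less[of "\<lambda>k. V k \<subseteq> span B" m] by (meson order_refl)
    then obtain v where v: "v \<in> V k" "v \<notin> span B" by blast
    define n where "n = v - (\<Sum>b\<in>B. ip v b *\<^sub>R b)"
    have "(\<Sum>b\<in>B. ip v b *\<^sub>R b) \<in> span B"
      by (intro span_sum span_scale span_base)
    then have "n \<noteq> 0" using v(2) by (auto simp: n_def)
    then have nn: "ip n n > 0" by (rule pos)
    have "ip v b *\<^sub>R b \<in> V k" if b: "b \<in> B" for b
    proof -
      obtain l where l: "b \<in> V l" "\<forall>x\<in>V (Suc l). ip x b = 0"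
        using B b unfolding adapted_def by blast
      show ?thesis
      proof (cases "k \<le> l")
        case True
        then show ?thesis using anti[of k l] l(1) sub by (auto intro: subspace_scale)
      next
        case False
        then have "v \<in> V (Suc l)" using anti[of "Suc l" k] v(1) by auto
        then show ?thesis using l(2) sub by (simp add: subspace_0)
      qed
    qed
    then have nV: "n \<in> V k"
      unfolding n_def using v(1) sub by (intro subspace_diff subspace_sum) auto
    have orth_B: "ip b n = 0" if "b \<in> B" for b
      using that sum_mult_orthonormal[OF on that, of "ip v"]
      by (simp add: n_def sym[of b] ip_simps)
    have orth: "ip x n = 0" if "x \<in> span B" for x
      using that by (induction rule: span_induct_alt) (auto simp: ip_simps orth_B)
    \<comment> \<open>The unit vector in direction \<open>n\<close> enlarges \<open>B\<close>, with level \<open>k\<close>.\<close>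
    define e where "e = (1 / sqrt (ip n n)) *\<^sub>R n"
    have ee: "ip e e = 1" using nn by (simp add: e_def ip_simps field_simps)
    have orth_e: "ip x e = 0" "ip e x = 0" if "x \<in> span B" for x
      using orth[OF that] sym[of x e] by (simp_all add: e_def ip_simps)
    have "e \<notin> B" using orth_e(1)[of e] ee by (auto intro: span_base)
    have "e \<in> V k" using nV sub by (simp add: e_def subspace_scale)
    moreover have "\<forall>x\<in>V (Suc k). ip x e = 0" using orth_e(1) k(2) by blast
    ultimately have "adapted (insert e B)"
      using B ee orth_e[OF span_base] \<open>e \<notin> B\<close> unfolding adapted_def orthonormal_def by auto
    from max[OF this] show False using \<open>e \<notin> B\<close> fin by simp
  qed
  then show thesis using that B by (auto simp: adapted_def)
qed

end

section \<open>The Ricci form on the diagonal\<close>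

locale metric_algebra = inner_product ip for ip :: "'a::real_vector \<Rightarrow> 'a \<Rightarrow> real" +
  fixes mul :: "'a \<Rightarrow> 'a \<Rightarrow> 'a"
  assumes fd: "finite_dimensional TYPE('a)"
    and bilinear_mul: "bilinear mul" and commute: "mul X Y = mul Y X"
begin

abbreviation D :: "'a \<Rightarrow> 'a \<Rightarrow> 'a" where
  "D \<equiv> jordan_levi_civita mul ip"

lemma levi_civita: "is_jordan_levi_civita mul ip D"
  unfolding jordan_levi_civita_def
  by (rule theI'[OF ex1_jordan_levi_civita[OF fd bilinear_mul commute ip]])

lemma bilinear_D: "bilinear D"
  and D_add_D: "D X Y + D Y X = mul X Y"
  and D_self_adjoint: "ip (D X Y) Z = ip Y (D X Z)"
  using levi_civita by (auto simp: is_jordan_levi_civita_def)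

lemma linear_D_left: "linear (\<lambda>X. D X Y)" and linear_D_right: "linear (D X)"
  and linear_mul_left: "linear (\<lambda>X. mul X Y)" and linear_mul_right: "linear (mul X)"
  using bilinear_D bilinear_mul by (auto simp: bilinear_def)

text \<open>Splitting the product in the last curvature term as \<open>mul U b = D U b + D b U\<close>, the first part
  cancels against the first curvature term by cyclicity of the trace, and the second part gives the
  trace below. The middle curvature term is evaluated by moving the self-adjoint \<open>D b\<close> to the other
  side.\<close>

lemma jordan_ric_diagonal:
  assumes B: "orthonormal ip B" "span B = UNIV"
  shows "jordan_ric mul ip U U = (\<Sum>b\<in>B. ip (D (D b U) U) b) - ip (D U U) (\<Sum>b\<in>B. D b b)"
proof -
  have "linear (\<lambda>X. jordan_curvature mul ip U X U)"
    unfolding jordan_curvature_def Let_def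
    by (intro linear_compose_add linear_compose_sub linear_compose_neg
        linear_compose[OF linear_D_left linear_D_right, unfolded o_def]
        linear_compose[OF linear_mul_right linear_D_left, unfolded o_def] linear_D_left)
  then have "jordan_ric mul ip U U = (\<Sum>b\<in>B. ip (jordan_curvature mul ip U b U) b)"
    unfolding jordan_ric_def by (rule endo_trace_orthonormal[OF B])
  also have "\<dots> = - (\<Sum>b\<in>B. ip (D U (D b U)) b) - (\<Sum>b\<in>B. ip (D b (D U U)) b)
      + ((\<Sum>b\<in>B. ip (D (D U b) U) b) + (\<Sum>b\<in>B. ip (D (D b U) U) b))"
    by (simp add: jordan_curvature_def Let_def ip_simps sum.distrib sum_subtractf sum_negf
        linear_add[OF linear_D_left] D_add_D[of U, symmetric])
  also have "(\<Sum>b\<in>B. ip (D (D U b) U) b) = (\<Sum>b\<in>B. ip (D U (D b U)) b)"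
    by (rule trace_comp_commute[OF B linear_D_left linear_D_right])
  also have "(\<Sum>b\<in>B. ip (D b (D U U)) b) = ip (D U U) (\<Sum>b\<in>B. D b b)"
    by (simp add: ip_simps D_self_adjoint)
  finally show ?thesis by simp
qed

text \<open>By the Koszul formula the matrix of \<open>X \<mapsto> D X U\<close> is half the sum of the symmetric matrix
  \<open>s b c = \<langle>b c, U\<rangle>\<close> and the skew part \<open>x b c - x c b\<close>, where \<open>x\<close> is the matrix of multiplication by
  \<open>U\<close>. In the trace of the square the mixed terms cancel, and the skew part enters with a minus
  sign; this is the source of the negative term.\<close>

lemma jordan_ric_structure_constants:
  assumes B: "orthonormal ip B" "span B = UNIV"
  shows "jordan_ric mul ip U U =
    (\<Sum>b\<in>B. \<Sum>c\<in>B. (ip (mul b c) U)\<^sup>2) / 4 - (\<Sum>b\<in>B. \<Sum>c\<in>B. (ip (mul U b) c)\<^sup>2) / 2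
    + (\<Sum>b\<in>B. ip (mul U (mul U b)) b) / 2 - ip (D U U) (\<Sum>b\<in>B. D b b)"
proof -
  define x where "x b c = ip (mul U b) c" for b c
  define s where "s b c = ip (mul b c) U" for b c
  have koszul: "ip (D b U) c = (x b c - x c b + s b c) / 2" for b c
    using is_jordan_levi_civita_koszul[OF ip levi_civita, of b U c]
    by (simp add: x_def s_def commute[of b U] commute[of c b])
  have s_sym: "s c b = s b c" for b c by (simp add: s_def commute)
  have "(\<Sum>b\<in>B. ip (D (D b U) U) b) = (\<Sum>b\<in>B. \<Sum>c\<in>B. ip (D b U) c * ip (D c U) b)"
    by (rule trace_comp_matrix[OF B linear_D_left])
  also have "\<dots> = (\<Sum>b\<in>B. \<Sum>c\<in>B. (s b c)\<^sup>2 / 4 - (x b c)\<^sup>2 / 4 - (x c b)\<^sup>2 / 4 + x b c * x c b / 2)"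
    by (intro sum.cong refl) (simp add: koszul s_sym field_simps power2_eq_square)
  also have "\<dots> = (\<Sum>b\<in>B. \<Sum>c\<in>B. (s b c)\<^sup>2) / 4 - (\<Sum>b\<in>B. \<Sum>c\<in>B. (x b c)\<^sup>2) / 4
      - (\<Sum>b\<in>B. \<Sum>c\<in>B. (x c b)\<^sup>2) / 4 + (\<Sum>b\<in>B. \<Sum>c\<in>B. x b c * x c b) / 2"
    by (simp add: sum.distrib sum_subtractf sum_divide_distrib)
  also have "(\<Sum>b\<in>B. \<Sum>c\<in>B. (x c b)\<^sup>2) = (\<Sum>b\<in>B. \<Sum>c\<in>B. (x b c)\<^sup>2)"
    by (rule sum.swap)
  also have "(\<Sum>b\<in>B. \<Sum>c\<in>B. x b c * x c b) = (\<Sum>b\<in>B. ip (mul U (mul U b)) b)"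
    unfolding x_def by (rule trace_comp_matrix[OF B linear_mul_right, symmetric])
  finally show ?thesis
    by (simp add: jordan_ric_diagonal[OF B] x_def s_def)
qed

text \<open>For an annihilating \<open>Z\<close> every term with multiplication by \<open>Z\<close> drops out, including
  \<open>D Z Z = mul Z Z / 2\<close>, and only the sum of squares from the symmetric part is left.\<close>

lemma jordan_ric_annihilator_nonneg:
  assumes B: "orthonormal ip B" "span B = UNIV" and Z: "\<And>X. mul Z X = 0"
  shows "jordan_ric mul ip Z Z \<ge> 0"
proof -
  have "2 *\<^sub>R D Z Z = 0" using D_add_D[of Z Z] Z by (simp add: scaleR_2)
  then have "D Z Z = 0" by simp
  then show ?thesis
    by (simp add: jordan_ric_structure_constants[OF B] Z ip_simps sum_nonneg)
qed

section \<open>Powers of a nilpotent algebra\<close>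

lemma subspace_algebra_power: "subspace (algebra_power mul k)"
  by (cases k) (auto simp: subspace_UNIV subspace_span)

lemma mul_in_algebra_power: "Y \<in> algebra_power mul k \<Longrightarrow> mul X Y \<in> algebra_power mul (Suc k)"
  by (auto intro: span_base)

lemma algebra_power_Suc_subset: "algebra_power mul (Suc k) \<subseteq> algebra_power mul k"
proof (induction k)
  case (Suc k)
  then have "{mul X Y | X Y. Y \<in> algebra_power mul (Suc k)} \<subseteq> {mul X Y | X Y. Y \<in> algebra_power mul k}"
    by blast
  from span_mono[OF this] show ?case by simp
qed simp

text \<open>The last nonzero power is multiplied into zero by the whole algebra.\<close>

lemma nilpotent_annihilator:
  assumes "nilpotent_algebra mul" "mul X Y \<noteq> 0"
  obtains Z where "Z \<noteq> 0" "\<And>X. mul Z X = 0"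
proof -
  obtain m where "algebra_power mul m = {0}"
    using assms by (auto simp: nilpotent_algebra_def)
  moreover have "algebra_power mul 0 \<noteq> {0}"
    using assms(2) by auto
  ultimately obtain k where k: "algebra_power mul k \<noteq> {0}" "algebra_power mul (Suc k) = {0}"
    using ex_least_nat_less[of "\<lambda>k. algebra_power mul k = {0}" m] by (meson order_refl)
  have "0 \<in> algebra_power mul k" by (rule subspace_0[OF subspace_algebra_power])
  with k(1) obtain Z where Z: "Z \<in> algebra_power mul k" "Z \<noteq> 0"
    by blast
  have "mul Z X = 0" for X
    using mul_in_algebra_power[OF Z(1), of X] k(2) by (simp add: commute[of Z])
  then show thesis using that Z(2) by blast
qed

text \<open>In a basis adapted to the powers, any composition of two multiplications is strictly
  triangular, so its diagonal entries vanish. In particular \<open>tr (L\<^sub>U \<circ> L\<^sub>U) = 0\<close>.\<close>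

lemma nilpotent_adapted_basis:
  assumes "nilpotent_algebra mul"
  obtains B where "orthonormal ip B" "span B = UNIV"
    "\<And>X Y b. b \<in> B \<Longrightarrow> ip (mul X (mul Y b)) b = 0"
proof -
  obtain m where m: "algebra_power mul m = {0}"
    using assms by (auto simp: nilpotent_algebra_def)
  obtain B where B: "orthonormal ip B" "span B = UNIV"
    and adapted: "\<And>b. b \<in> B \<Longrightarrow> \<exists>k. b \<in> algebra_power mul k \<and> (\<forall>x\<in>algebra_power mul (Suc k). ip x b = 0)"
    using adapted_orthonormal_basis[OF fd subspace_algebra_power algebra_power_Suc_subset
        algebra_power.simps(1) m] by blast
  have "ip (mul X (mul Y b)) b = 0" if "b \<in> B" for X Y b
    using adapted[OF that] mul_in_algebra_power algebra_power_Suc_subset by blast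
  with B show thesis by (rule that)
qed

section \<open>Negativity of the scalar curvature\<close>

lemma sum_structure_constants_pos:
  assumes B: "orthonormal ip B" "span B = UNIV" and XY: "mul X Y \<noteq> 0"
  shows "(\<Sum>a\<in>B. \<Sum>b\<in>B. \<Sum>c\<in>B. (ip (mul a b) c)\<^sup>2) > 0"
proof (rule ccontr)
  have fin: "finite B" using B by (simp add: orthonormal_def)
  have nn: "(\<Sum>a\<in>B. \<Sum>b\<in>B. \<Sum>c\<in>B. (ip (mul a b) c)\<^sup>2) \<ge> 0"
    by (intro sum_nonneg) auto
  assume "\<not> ?thesis"
  with nn have "(\<Sum>a\<in>B. \<Sum>b\<in>B. \<Sum>c\<in>B. (ip (mul a b) c)\<^sup>2) = 0" by linarith
  then have *: "ip (mul a b) c = 0" if "a \<in> B" "b \<in> B" "c \<in> B" for a b c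
    using that fin by (simp add: sum_nonneg_eq_0_iff sum_nonneg)
  have "mul a b = 0" if "a \<in> B" "b \<in> B" for a b
    using orthonormal_expansion(2)[OF B, of "mul a b"] * that by simp
  then have "mul X Y = 0"
    using bilinear_eq[OF bilinear_mul, of "\<lambda>_ _. 0" UNIV B UNIV B X Y] B(2)
    by (auto simp: bilinear_def linear_zero)
  with XY show False by simp
qed

text \<open>The sums of \<open>|J\<^sub>U|\<^sup>2\<close> and of \<open>|L\<^sub>U|\<^sup>2\<close> over the basis run over the same structure constants in a different
  order; since the former has weight one quarter and the latter minus one half, they
  add up to something negative. The remaining term contributes \<open>- |H|\<^sup>2 \<le> 0\<close>.\<close>

lemma nilpotent_scalar_curvature_neg:
  assumes "nilpotent_algebra mul" "mul X Y \<noteq> 0"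
  obtains B where "orthonormal ip B" "span B = UNIV" "(\<Sum>u\<in>B. jordan_ric mul ip u u) < 0"
proof -
  obtain B where B: "orthonormal ip B" "span B = UNIV"
    and tr0: "\<And>X Y b. b \<in> B \<Longrightarrow> ip (mul X (mul Y b)) b = 0"
    using nilpotent_adapted_basis[OF assms(1)] by blast
  define N where "N = (\<Sum>a\<in>B. \<Sum>b\<in>B. \<Sum>c\<in>B. (ip (mul a b) c)\<^sup>2)"
  define H where "H = (\<Sum>b\<in>B. D b b)"
  have J: "(\<Sum>u\<in>B. \<Sum>b\<in>B. \<Sum>c\<in>B. (ip (mul b c) u)\<^sup>2) = N"
  proof -
    have "(\<Sum>u\<in>B. \<Sum>b\<in>B. \<Sum>c\<in>B. (ip (mul b c) u)\<^sup>2) = (\<Sum>b\<in>B. \<Sum>u\<in>B. \<Sum>c\<in>B. (ip (mul b c) u)\<^sup>2)"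
      by (rule sum.swap)
    also have "\<dots> = N" unfolding N_def by (intro sum.cong refl sum.swap)
    finally show ?thesis .
  qed
  have "(\<Sum>u\<in>B. jordan_ric mul ip u u) =
      (\<Sum>u\<in>B. (\<Sum>b\<in>B. \<Sum>c\<in>B. (ip (mul b c) u)\<^sup>2) / 4 - (\<Sum>b\<in>B. \<Sum>c\<in>B. (ip (mul u b) c)\<^sup>2) / 2
        - ip (D u u) H)"
    by (simp add: jordan_ric_structure_constants[OF B] tr0 H_def)
  also have "\<dots> = N / 4 - N / 2 - ip H H"
    by (simp only: sum_subtractf sum_divide_distrib[symmetric] J N_def[symmetric])
      (simp add: H_def linear_sum[OF linear_left])
  also have "\<dots> < 0"
    using sum_structure_constants_pos[OF B assms(2)] nonneg[of H] by (simp add: N_def)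
  finally show thesis using that B by blast
qed

end

section \<open>Nonexistence of Jordan-Einstein metrics\<close>

theorem theorem5p9:
  fixes mul :: "'a::real_vector \<Rightarrow> 'a \<Rightarrow> 'a"
  assumes "finite_dimensional TYPE('a)"
    and "jordan_algebra mul"
    and "nilpotent_algebra mul"
    and "\<exists>X Y. mul X Y \<noteq> 0"
  shows "\<not> (\<exists>ip :: 'a \<Rightarrow> 'a \<Rightarrow> real. jordan_einstein_metric mul ip)"
proof
  assume "\<exists>ip :: 'a \<Rightarrow> 'a \<Rightarrow> real. jordan_einstein_metric mul ip"
  then obtain ip :: "'a \<Rightarrow> 'a \<Rightarrow> real" and c :: real where ip: "is_inner_product ip"
    and Ric: "\<And>U V. jordan_Ric mul ip U V = c * ip U V"
    by (auto simp: jordan_einstein_metric_def)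
  interpret metric_algebra ip mul
    using assms ip by unfold_locales (auto simp: jordan_algebra_def)
  have ric: "jordan_ric mul ip U U = c * ip U U" for U
    using Ric[of U U] by (simp add: jordan_Ric_def)
  obtain X Y where XY: "mul X Y \<noteq> 0" using assms by blast
  obtain B where B: "orthonormal ip B" "span B = UNIV" "(\<Sum>u\<in>B. jordan_ric mul ip u u) < 0"
    by (rule nilpotent_scalar_curvature_neg[OF assms(3) XY])
  have "(\<Sum>u\<in>B. jordan_ric mul ip u u) = real (card B) * c"
    using B(1) by (simp add: ric orthonormal_def)
  with B(3) have "c < 0" by (simp add: mult_less_0_iff)
  obtain Z where Z: "Z \<noteq> 0" "\<And>X. mul Z X = 0"
    using nilpotent_annihilator[OF assms(3) XY] by blast
  have "c * ip Z Z < 0" using \<open>c < 0\<close> pos[OF Z(1)] by (rule mult_neg_pos)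
  with jordan_ric_annihilator_nonneg[OF B(1,2) Z(2)] ric[of Z] show False by simp
qed

end
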